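(* Every Hausdorff SDL $P$-space of character at most $\omega_1$ is regular.
   Context: A $P$-space is a topological space in which every $G_\delta$ set (countable intersection of open sets) is open. A space has character at most $\omega_1$ if every point has a local base of cardinality at most $\omega_1$. A space is Lindelöf if every open cover has a countable subcover. A subset $D$ of a topological space $X$ is strongly discrete if for every $x \in D$ there is an open neighbourhood $U_x \subset X$ of $x$ such that $U_x\cap U_y=\emptyset$ for distinct $x,y\in D$. A space $X$ is SDL if the closure in $X$ of every strongly discrete subset of $X$ is Lindelöf. *)

theory Defs
  imports "HOL-Analysis.Analysis"
begin

unbundle cardinal_syntax

definition P_space :: "'a topology \<Rightarrow> bool" where
  "P_space X \<longleftrightarrow> (\<forall>S. gdelta_in X S \<longrightarrow> openin X S)"

definition local_base_at :: "'a topology \<Rightarrow> 'a \<Rightarrow> 'a set set \<Rightarrow> bool" where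
  "local_base_at X x \<B> \<longleftrightarrow>
     (\<forall>B\<in>\<B>. openin X B \<and> x \<in> B) \<and>
     (\<forall>U. openin X U \<and> x \<in> U \<longrightarrow> (\<exists>B\<in>\<B>. B \<subseteq> U))"

(* omega_1 is the cardinal successor of natLeq, the order of type omega. *)
definition character_le_omega1 :: "'a topology \<Rightarrow> bool" where
  "character_le_omega1 X \<longleftrightarrow>
     (\<forall>x\<in>topspace X. \<exists>\<B>. local_base_at X x \<B> \<and> |\<B>| \<le>o cardSuc natLeq)"

definition strongly_discrete_in :: "'a topology \<Rightarrow> 'a set \<Rightarrow> bool" where
  "strongly_discrete_in X D \<longleftrightarrow>
     D \<subseteq> topspace X \<and>
     (\<exists>U. (\<forall>x\<in>D. openin X (U x) \<and> x \<in> U x) \<and>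
          (\<forall>x\<in>D. \<forall>y\<in>D. x \<noteq> y \<longrightarrow> U x \<inter> U y = {}))"

definition SDL_space :: "'a topology \<Rightarrow> bool" where
  "SDL_space X \<longleftrightarrow>
     (\<forall>D. strongly_discrete_in X D \<longrightarrow> Lindelof_space (subtopology X (X closure_of D)))"

end

theory Submission
  imports Defs "HOL-Library.Countable_Set_Type"
begin

text \<open>
  Suppose the point \<open>a\<close> and the closed set \<open>C\<close> cannot be separated. Transfinite recursion along a
  local base of \<open>a\<close> (each stage sees only countably many earlier ones, so the P-property applies)
  yields disjoint open sets \<open>O\<close> that converge to \<open>a\<close> and that each have a point \<open>y O \<in> C\<close> in
  their closure. The same recursion at \<open>y O\<close> yields disjoint nonempty open subsets of \<open>O\<close> that
  converge to \<open>y O\<close>. One point from each of these small sets gives a strongly discrete set \<open>D\<close>.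
  The part of \<open>C\<close> in the closure of \<open>D\<close> is Lindelof, hence can be separated from \<open>a\<close> in a
  Hausdorff P-space; but it contains every \<open>y O\<close>, which contradicts the convergence.
\<close>

lemma P_space_openin_Inter:
  assumes "P_space X" "countable \<U>" "\<U> \<noteq> {}" "\<And>U. U \<in> \<U> \<Longrightarrow> openin X U"
  shows "openin X (\<Inter>\<U>)"
  using assms gdelta_in_Inter[of \<U> X] open_imp_gdelta_in unfolding P_space_def by blast

text \<open>Separate \<open>a\<close> from each point of \<open>K\<close>. Countably many of the
  sets around points of \<open>K\<close> suffice to cover it, and the P-property keeps the
  intersection of the matching neighbourhoods of \<open>a\<close> open.\<close>

lemma Hausdorff_P_space_separate_Lindelof:
  assumes "Hausdorff_space X" "P_space X" "Lindelof_space (subtopology X K)"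
    and "K \<subseteq> topspace X" "a \<in> topspace X" "a \<notin> K"
  obtains U V where "openin X U" "openin X V" "a \<in> U" "K \<subseteq> V" "disjnt U V"
proof -
  have "\<forall>y\<in>K. \<exists>V U. openin X U \<and> openin X V \<and> a \<in> U \<and> y \<in> V \<and> disjnt U V"
    using assms unfolding Hausdorff_space_def by (metis subsetD)
  then obtain V U where VU:
    "\<And>y. y \<in> K \<Longrightarrow> openin X (U y) \<and> openin X (V y) \<and> a \<in> U y \<and> y \<in> V y \<and> disjnt (U y) (V y)"
    by metis
  have "\<exists>\<V>. countable \<V> \<and> \<V> \<subseteq> V ` K \<and> K \<subseteq> \<Union>\<V>"
    using assms(3)[unfolded Lindelof_space_subtopology_subset[OF assms(4)], rule_format, of "V ` K"]
      VU by blast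
  then obtain T where T: "countable T" "T \<subseteq> K" "K \<subseteq> \<Union>(V ` T)"
    by (metis countable_subset_image)
  show thesis
  proof
    \<comment> \<open>Inserting \<open>topspace X\<close> keeps the family nonempty when
      \<open>K\<close> is empty.\<close>
    show "openin X (\<Inter>(insert (topspace X) (U ` T)))"
      by (rule P_space_openin_Inter) (use assms T VU in auto)
    show "openin X (\<Union>(V ` T))" using T VU by blast
    show "a \<in> \<Inter>(insert (topspace X) (U ` T))" using assms T VU by auto
    show "disjnt (\<Inter>(insert (topspace X) (U ` T))) (\<Union>(V ` T))"
      using T VU by (fastforce simp: disjnt_iff)
  qed (fact T)
qed

text \<open>\<open>|\<B>|\<close> is a well-order of least type on \<open>\<B>\<close>, so a proper
  initial segment has cardinality strictly below that of \<open>\<B>\<close>, hence below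
  omega_1.\<close>

lemma countable_underS_card_of:
  assumes "|\<B>| \<le>o cardSuc natLeq"
  shows "countable (underS ( |\<B>| ) b)"
proof (cases "b \<in> \<B>")
  case True
  then have "|underS ( |\<B>| ) b| <o |\<B>|"
    by (intro card_of_underS card_of_Card_order) (simp add: Field_card_of True)
  then have "|underS ( |\<B>| ) b| <o cardSuc natLeq"
    using assms ordLess_ordLeq_trans by blast
  then have "|underS ( |\<B>| ) b| \<le>o natLeq"
    by (simp add: cardSuc_ordLeq_ordLess natLeq_Card_order card_of_Card_order)
  then show ?thesis
    by (simp add: countable_card_le_natLeq)
next
  case False
  then have "underS ( |\<B>| ) b = {}"
    unfolding underS_def by (metis (mono_tags, lifting) Collect_empty_eq FieldI2 Field_card_of)
  then show ?thesis by simp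
qed

text \<open>The transfinite recursion: the \<open>i\<close>-th set is chosen inside the \<open>i\<close>-th basic set and inside
  the neighbourhoods of \<open>p\<close> that avoid the earlier sets.\<close>

lemma disjoint_open_sets_converging:
  assumes "P_space X" "character_le_omega1 X" "p \<in> topspace X"
    and ex: "\<And>N. openin X N \<Longrightarrow> p \<in> N \<Longrightarrow>
      \<exists>G M. openin X G \<and> Q G \<and> G \<subseteq> N \<and> openin X M \<and> p \<in> M \<and> disjnt G M"
  obtains \<G> where "\<And>G. G \<in> \<G> \<Longrightarrow> openin X G \<and> Q G" "pairwise disjnt \<G>"
    "\<And>N. openin X N \<Longrightarrow> p \<in> N \<Longrightarrow> \<exists>G\<in>\<G>. G \<subseteq> N"
proof -
  obtain \<B> where \<B>: "local_base_at X p \<B>" "|\<B>| \<le>o cardSuc natLeq"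
    using assms unfolding character_le_omega1_def by blast
  let ?R = "|\<B>| - Id"
  \<comment> \<open>The value at \<open>i\<close> is a pair: the set chosen there and a
    neighbourhood of \<open>p\<close> avoiding it, to which all later stages are confined. The guard
    \<open>i \<in> \<B>\<close> is there because the recursion runs over the whole type.\<close>
  define P where "P f i r \<longleftrightarrow> (i \<in> \<B> \<longrightarrow> openin X (fst r) \<and> Q (fst r) \<and>
      fst r \<subseteq> i \<inter> (\<Inter>j\<in>underS ( |\<B>| ) i. snd (f j)) \<and>
      openin X (snd r) \<and> p \<in> snd r \<and> disjnt (fst r) (snd r))"
    for f :: "'a set \<Rightarrow> 'a set \<times> 'a set" and i r
  have wo: "Well_order |\<B>|" by (rule card_of_Well_order)
  have "\<exists>f. \<forall>i. P f i (f i)"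
  proof (rule dependent_wf_choice)
    show "wf ?R" using wo unfolding well_order_on_def by blast
    fix f g :: "'a set \<Rightarrow> 'a set \<times> 'a set" and i r
    assume "\<And>j. (j, i) \<in> ?R \<Longrightarrow> f j = g j"
    then have "(\<Inter>j\<in>underS ( |\<B>| ) i. snd (f j)) = (\<Inter>j\<in>underS ( |\<B>| ) i. snd (g j))"
      by (intro INF_cong) (auto simp: underS_def)
    then show "P f i r = P g i r" unfolding P_def by simp
  next
    fix i and f :: "'a set \<Rightarrow> 'a set \<times> 'a set"
    assume IH: "\<And>j. (j, i) \<in> ?R \<Longrightarrow> P f j (f j)"
    show "\<exists>r. P f i r"
    proof (cases "i \<in> \<B>")
      case True
      have prev: "openin X (snd (f j)) \<and> p \<in> snd (f j)" if "j \<in> underS ( |\<B>| ) i" for j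
      proof -
        have "j \<in> \<B>"
          using that unfolding underS_def
          by (metis (mono_tags, lifting) FieldI1 Field_card_of mem_Collect_eq)
        moreover have "P f j (f j)" using IH that by (auto simp: underS_def)
        ultimately show ?thesis unfolding P_def by simp
      qed
      \<comment> \<open>Only countably many earlier stages contribute, so \<open>?N\<close> is open.
        The member \<open>i\<close> makes the family nonempty and later gives the convergence to
        \<open>p\<close>.\<close>
      let ?N = "\<Inter>(insert i ((\<lambda>j. snd (f j)) ` underS ( |\<B>| ) i))"
      have "openin X ?N"
        by (rule P_space_openin_Inter)
          (use assms prev True \<B> countable_underS_card_of[OF \<B>(2)] in \<open>auto simp: local_base_at_def\<close>)
      moreover have "p \<in> ?N" using prev True \<B> by (auto simp: local_base_at_def)
      ultimately obtain G M where
        "openin X G \<and> Q G \<and> G \<subseteq> ?N \<and> openin X M \<and> p \<in> M \<and> disjnt G M"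
        using ex[of ?N] by auto
      then have "P f i (G, M)" unfolding P_def by auto
      then show ?thesis ..
    qed (simp add: P_def)
  qed
  then obtain f where f: "\<And>i. P f i (f i)" by blast
  have lt: "disjnt (fst (f i)) (fst (f j))" if "(j, i) \<in> |\<B>|" "i \<noteq> j" "i \<in> \<B>" "j \<in> \<B>" for i j
  proof -
    have "fst (f i) \<subseteq> snd (f j)" using f[of i] that unfolding P_def underS_def by auto
    moreover have "disjnt (fst (f j)) (snd (f j))" using f[of j] that unfolding P_def by simp
    ultimately show ?thesis unfolding disjnt_def by blast
  qed
  have tot: "(i, j) \<in> |\<B>| \<or> (j, i) \<in> |\<B>|" if "i \<in> \<B>" "j \<in> \<B>" "i \<noteq> j" for i j
    using wo that unfolding well_order_on_def linear_order_on_def total_on_def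
    by (auto simp: Field_card_of)
  show thesis
  proof
    show "openin X G \<and> Q G" if "G \<in> (\<lambda>i. fst (f i)) ` \<B>" for G
      using that f unfolding P_def by blast
    show "pairwise disjnt ((\<lambda>i. fst (f i)) ` \<B>)"
    proof (rule pairwiseI, elim imageE)
      fix G H i j assume "G = fst (f i)" "H = fst (f j)" "i \<in> \<B>" "j \<in> \<B>" "G \<noteq> H"
      then show "disjnt G H" using lt[of i j] lt[of j i] tot[of i j] disjnt_sym by metis
    qed
    show "\<exists>G\<in>(\<lambda>i. fst (f i)) ` \<B>. G \<subseteq> N" if N: "openin X N" "p \<in> N" for N
    proof -
      obtain i where "i \<in> \<B>" "i \<subseteq> N" using \<B>(1) N unfolding local_base_at_def by meson
      moreover from this have "fst (f i) \<subseteq> i" using f[of i] unfolding P_def by auto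
      ultimately show ?thesis by (meson image_eqI order_trans)
    qed
  qed
qed

text \<open>Every neighbourhood of \<open>y\<close> meets \<open>G\<close>, in a point other than
  \<open>y\<close> since \<open>y \<notin> G\<close>. Separating the two points provides what the
  recursion demands.\<close>

lemma disjoint_open_subsets_converging_to_boundary:
  assumes "Hausdorff_space X" "P_space X" "character_le_omega1 X"
    and "openin X G" "y \<in> X closure_of G" "y \<notin> G"
  obtains \<H> where "\<And>H. H \<in> \<H> \<Longrightarrow> openin X H \<and> H \<noteq> {} \<and> H \<subseteq> G" "pairwise disjnt \<H>"
    "\<And>N. openin X N \<Longrightarrow> y \<in> N \<Longrightarrow> \<exists>H\<in>\<H>. H \<subseteq> N"
proof -
  have y: "y \<in> topspace X" using assms(5) in_closure_of by metis
  show thesis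
  proof (rule disjoint_open_sets_converging[OF assms(2,3) y, where Q = "\<lambda>H. H \<noteq> {} \<and> H \<subseteq> G"])
    fix N assume N: "openin X N" "y \<in> N"
    then obtain z where z: "z \<in> G" "z \<in> N" using assms(5) unfolding in_closure_of by blast
    moreover have "z \<in> topspace X" "z \<noteq> y"
      using z N openin_subset assms(6) by blast+
    ultimately obtain A M where "openin X A" "openin X M" "z \<in> A" "y \<in> M" "disjnt A M"
      using assms(1) y unfolding Hausdorff_space_def by metis
    then show "\<exists>H M. openin X H \<and> (H \<noteq> {} \<and> H \<subseteq> G) \<and> H \<subseteq> N \<and> openin X M \<and> y \<in> M \<and> disjnt H M"
      using z N assms(4)
      by (intro exI[of _ "A \<inter> (G \<inter> N)"] exI[of _ M]) (auto simp: disjnt_def)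
  qed (use that in blast)
qed

theorem theorem12:
  fixes X :: "'a topology"
  assumes "Hausdorff_space X"
    and "SDL_space X"
    and "P_space X"
    and "character_le_omega1 X"
  shows "regular_space X"
proof (rule ccontr)
  assume "\<not> regular_space X"
  then obtain C a where C: "closedin X C" "a \<in> topspace X" "a \<notin> C"
    and nosep: "\<And>U V. \<lbrakk>openin X U; openin X V; a \<in> U; C \<subseteq> V\<rbrakk> \<Longrightarrow> \<not> disjnt U V"
    unfolding regular_space_def by (metis DiffE)
  have Csub: "C \<subseteq> topspace X" using C closedin_subset by blast
  \<comment> \<open>The condition \<open>y \<notin> G\<close> makes \<open>y\<close> a boundary
    point, so that the second recursion can be run inside \<open>G\<close>.\<close>
  let ?Q = "\<lambda>G. \<exists>y\<in>C. y \<in> X closure_of G \<and> y \<notin> G"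
  obtain \<G> where \<G>: "\<And>G. G \<in> \<G> \<Longrightarrow> openin X G \<and> ?Q G" "pairwise disjnt \<G>"
    "\<And>N. openin X N \<Longrightarrow> a \<in> N \<Longrightarrow> \<exists>G\<in>\<G>. G \<subseteq> N"
  proof (rule disjoint_open_sets_converging[OF assms(3,4) C(2), where Q = ?Q])
    fix N assume N: "openin X N" "a \<in> N"
    define N' where "N' = N - C"
    have N': "openin X N'" "a \<in> N'" "N' \<inter> C = {}"
      using N C by (auto simp: N'_def intro: openin_diff)
    \<comment> \<open>Otherwise the complement of the closure of \<open>N'\<close> would be an open
      set around \<open>C\<close> disjoint from \<open>N'\<close>, separating \<open>a\<close> from
      \<open>C\<close>.\<close>
    have "\<exists>y\<in>C. y \<in> X closure_of N'"
    proof (rule ccontr)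
      assume "\<not> ?thesis"
      then have "C \<subseteq> topspace X - X closure_of N'" using Csub by blast
      moreover have "disjnt N' (topspace X - X closure_of N')"
        using closure_of_subset[OF openin_subset[OF N'(1)]] unfolding disjnt_def by blast
      ultimately show False
        using nosep[of N' "topspace X - X closure_of N'"] N' by (simp add: openin_diff)
    qed
    then obtain y where y: "y \<in> C" "y \<in> X closure_of N'" by blast
    then have "y \<noteq> a" "y \<in> topspace X" using C Csub by auto
    then obtain W M where WM: "openin X W" "openin X M" "y \<in> W" "a \<in> M" "disjnt W M"
      using assms(1) C unfolding Hausdorff_space_def by metis
    \<comment> \<open>Cutting down to the neighbourhood \<open>W\<close> of \<open>y\<close> keeps
      \<open>y\<close> in the closure and moves the set away from \<open>a\<close>.\<close>
    have "y \<in> X closure_of (W \<inter> N')"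
      using y WM unfolding in_closure_of by (metis IntI IntE openin_Int)
    then show "\<exists>G M. openin X G \<and> ?Q G \<and> G \<subseteq> N \<and> openin X M \<and> a \<in> M \<and> disjnt G M"
      using y WM N' by (intro exI[of _ "W \<inter> N'"] exI[of _ M]) (auto simp: disjnt_def N'_def)
  qed (use that in blast)
  then obtain y where y: "\<And>G. G \<in> \<G> \<Longrightarrow> y G \<in> C \<and> y G \<in> X closure_of G \<and> y G \<notin> G"
    by metis
  have "\<forall>G\<in>\<G>. \<exists>\<H>. (\<forall>H\<in>\<H>. openin X H \<and> H \<noteq> {} \<and> H \<subseteq> G) \<and> pairwise disjnt \<H> \<and>
      (\<forall>N. openin X N \<longrightarrow> y G \<in> N \<longrightarrow> (\<exists>H\<in>\<H>. H \<subseteq> N))"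
  proof
    fix G assume "G \<in> \<G>"
    then obtain \<H> where "\<And>H. H \<in> \<H> \<Longrightarrow> openin X H \<and> H \<noteq> {} \<and> H \<subseteq> G" "pairwise disjnt \<H>"
      "\<And>N. openin X N \<Longrightarrow> y G \<in> N \<Longrightarrow> \<exists>H\<in>\<H>. H \<subseteq> N"
      using disjoint_open_subsets_converging_to_boundary[OF assms(1,3,4), of G "y G"] y \<G>(1) by metis
    then show "\<exists>\<H>. (\<forall>H\<in>\<H>. openin X H \<and> H \<noteq> {} \<and> H \<subseteq> G) \<and> pairwise disjnt \<H> \<and>
      (\<forall>N. openin X N \<longrightarrow> y G \<in> N \<longrightarrow> (\<exists>H\<in>\<H>. H \<subseteq> N))" by blast
  qed
  then obtain \<H> where
    \<H>: "\<And>G H. G \<in> \<G> \<Longrightarrow> H \<in> \<H> G \<Longrightarrow> openin X H \<and> H \<noteq> {} \<and> H \<subseteq> G"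
    and dj: "\<And>G. G \<in> \<G> \<Longrightarrow> pairwise disjnt (\<H> G)"
    and conv: "\<And>G N. G \<in> \<G> \<Longrightarrow> openin X N \<Longrightarrow> y G \<in> N \<Longrightarrow> \<exists>H\<in>\<H> G. H \<subseteq> N"
    by metis
  define \<K> where "\<K> = (\<Union>G\<in>\<G>. \<H> G)"
  have \<K>: "openin X H \<and> H \<noteq> {}" if "H \<in> \<K>" for H using that \<H> unfolding \<K>_def by blast
  \<comment> \<open>Within one \<open>G\<close> this comes from the inner recursion, across
    different \<open>G\<close> from the outer one.\<close>
  have dj\<K>: "disjnt H H'" if HH': "H \<in> \<K>" "H' \<in> \<K>" "H \<noteq> H'" for H H'
  proof -
    obtain G G' where G: "G \<in> \<G>" "H \<in> \<H> G" "G' \<in> \<G>" "H' \<in> \<H> G'" using HH' unfolding \<K>_def by blast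
    show ?thesis
    proof (cases "G = G'")
      case True
      then show ?thesis using dj G that unfolding pairwise_def by blast
    next
      case False
      then have "disjnt G G'" using G \<G>(2) unfolding pairwise_def by blast
      then show ?thesis using \<H> G unfolding disjnt_def by blast
    qed
  qed
  obtain d where d: "\<And>H. H \<in> \<K> \<Longrightarrow> d H \<in> H" using \<K> by (metis all_not_in_conv)
  define D where "D = d ` \<K>"
  have Dsub: "D \<subseteq> topspace X" using d \<K> openin_subset unfolding D_def by blast
  \<comment> \<open>Disjointness makes \<open>d\<close> injective, so its inverse assigns to each
    point of \<open>D\<close> the open set it was picked from: the witness for strong
    discreteness.\<close>
  have "inj_on d \<K>" using d dj\<K> unfolding inj_on_def disjnt_def by (metis IntI empty_iff)
  then have inv: "the_inv_into \<K> d (d H) = H" if "H \<in> \<K>" for H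
    using that by (simp add: the_inv_into_f_f)
  have "strongly_discrete_in X D"
    unfolding strongly_discrete_in_def
  proof (intro conjI exI[of _ "the_inv_into \<K> d"] ballI impI)
    show "the_inv_into \<K> d u \<inter> the_inv_into \<K> d v = {}" if "u \<in> D" "v \<in> D" "u \<noteq> v" for u v
      using that dj\<K> inv unfolding D_def disjnt_def by (metis imageE)
  qed (use Dsub d \<K> inv in \<open>auto simp: D_def\<close>)
  then have L: "Lindelof_space (subtopology X (X closure_of D))"
    using assms(2) unfolding SDL_space_def by blast
  \<comment> \<open>\<open>K\<close> is closed in the Lindelof closure of \<open>D\<close>, hence
    Lindelof, and it misses \<open>a\<close> because \<open>C\<close> does.\<close>
  define K where "K = X closure_of D \<inter> C"
  have "closedin (subtopology X (X closure_of D)) K"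
    unfolding K_def using C closedin_subtopology by (metis inf_commute)
  then have "Lindelof_space (subtopology (subtopology X (X closure_of D)) K)"
    using L Lindelof_space_closedin_subtopology by blast
  moreover have "subtopology (subtopology X (X closure_of D)) K = subtopology X K"
    unfolding subtopology_subtopology by (simp add: K_def Int_assoc[symmetric])
  ultimately have "Lindelof_space (subtopology X K)" by simp
  then obtain U V where UV: "openin X U" "openin X V" "a \<in> U" "K \<subseteq> V" "disjnt U V"
    using Hausdorff_P_space_separate_Lindelof[OF assms(1,3), of K a] C Csub unfolding K_def by blast
  obtain G where G: "G \<in> \<G>" "G \<subseteq> U" using \<G>(3) UV by blast
  \<comment> \<open>Used twice: for arbitrary \<open>N\<close> it puts \<open>y G\<close> in the
    closure of \<open>D\<close>; for \<open>N = V\<close> it shows that \<open>V\<close> meets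
    \<open>G \<subseteq> U\<close>, against \<open>disjnt U V\<close>.\<close>
  have hit: "\<exists>H\<in>\<K>. H \<subseteq> N \<inter> G \<and> d H \<in> D \<and> d H \<in> H" if N: "openin X N" "y G \<in> N" for N
  proof -
    obtain H where "H \<in> \<H> G" "H \<subseteq> N" using conv G N by blast
    moreover from this have "H \<in> \<K>" "H \<subseteq> G" using G \<H> unfolding \<K>_def by blast+
    ultimately show ?thesis using d unfolding D_def by blast
  qed
  have "y G \<in> X closure_of D"
    unfolding in_closure_of using hit y[OF G(1)] Csub by blast
  then have "y G \<in> V" using y[OF G(1)] UV unfolding K_def by blast
  then obtain H where "H \<subseteq> V \<inter> G" "d H \<in> H" using hit[OF UV(2)] by blast
  then show False using G UV unfolding disjnt_def by blast
qed

end
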